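(* Let $\mathcal{A}$ be an abelian category and let $\mathcal{C}$ be a subcategory of $\mathcal{A}$ such that $\mathcal{C}\perp\mathcal{C}$ and $\mathcal{P}(\mathcal{A})$ is a generator for $\mathcal{C}$. Assume that $\mathcal{C}$ is closed under direct summands. Consider the following conditions. (1) $\mathcal{G}(\mathcal{C})^{\perp_1}=\mathcal{A}$. (2) $\mathcal{G}(\mathcal{C})\subseteq\mathcal{G}(\mathcal{C})^{\perp_1}$. (3) $\mathcal{G}(\mathcal{C})=\mathcal{C}$. Then $(1)\Rightarrow(2)\Rightarrow(3)$. If $\mathcal{C}$ is a projective generator for $\mathcal{A}$, then all three conditions are equivalent.
   Context: All subcategories of the abelian category $\mathcal{A}$ are full, additive and closed under isomorphisms. $\mathcal{P}(\mathcal{A})$ is the subcategory of projective objects of $\mathcal{A}$. For subcategories $\mathcal{X},\mathcal{Y}$ of $\mathcal{A}$, $\mathcal{X}\perp\mathcal{Y}$ means $\mathrm{Ext}^{i}_{\mathcal{A}}(X,Y)=0$ for all $i\geq 1$, $X\in\mathcal{X}$, $Y\in\mathcal{Y}$. For subcategories $\mathcal{X}\subseteq\mathcal{T}$ of $\mathcal{A}$, $\mathcal{X}$ is a generator for $\mathcal{T}$ if for every $T\in\mathcal{T}$ there is an exact sequence $0\to T'\to X\to T\to 0$ in $\mathcal{A}$ with $X\in\mathcal{X}$ and $T'\in\mathcal{T}$; it is a projective generator for $\mathcal{T}$ if moreover $\mathcal{X}\perp\mathcal{T}$. (In particular, $\mathcal{P}(\mathcal{A})$ being a generator for $\mathcal{C}$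 includes $\mathcal{P}(\mathcal{A})\subseteq\mathcal{C}$.) A sequence in $\mathcal{A}$ is $\mathrm{Hom}_{\mathcal{A}}(\mathcal{X},-)$-exact (resp. $\mathrm{Hom}_{\mathcal{A}}(-,\mathcal{X})$-exact) if it is exact after applying $\mathrm{Hom}_{\mathcal{A}}(X,-)$ (resp. $\mathrm{Hom}_{\mathcal{A}}(-,X)$) for every $X\in\mathcal{X}$. The Gorenstein subcategory $\mathcal{G}(\mathcal{C})$ consists of the objects $M$ of $\mathcal{A}$ for which there is an exact sequence $\cdots\to C_1\to C_0\to C^0\to C^1\to\cdots$ in $\mathcal{A}$ with all terms in $\mathcal{C}$, which is both $\mathrm{Hom}_{\mathcal{A}}(\mathcal{C},-)$-exact and $\mathrm{Hom}_{\mathcal{A}}(-,\mathcal{C})$-exact, such that $M\cong\mathrm{Im}(C_0\to C^0)$. $\mathcal{X}^{\perp_1}:=\{M\in\mathcal{A}\mid \mathrm{Ext}^1_{\mathcal{A}}(X,M)=0 \text{ for all } X\in\mathcal{X}\}$. *)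

theory Defs
  imports "HOL-Algebra.Coset"
begin

text \<open>
  Categories enriched in abelian groups are presented by a set of objects and a set of arrows;
  \<open>Add\<close> is meaningful on parallel arrows only, and \<open>Zer A X Y\<close> is the zero arrow from \<open>X\<close> to \<open>Y\<close>.
  Composition is written in the usual order: \<open>g \<cdot> f\<close> is \<open>g\<close> after \<open>f\<close>.
\<close>

record ('o, 'm) preadditive_data =
  Obj :: "'o set"
  Arr :: "'m set"
  Src :: "'m \<Rightarrow> 'o"
  Tgt :: "'m \<Rightarrow> 'o"
  Idt :: "'o \<Rightarrow> 'm"
  Cmp :: "'m \<Rightarrow> 'm \<Rightarrow> 'm"  (infixr "\<cdot>\<index>" 70)
  Add :: "'m \<Rightarrow> 'm \<Rightarrow> 'm"
  Zer :: "'o \<Rightarrow> 'o \<Rightarrow> 'm"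

definition Hom :: "('o, 'm) preadditive_data \<Rightarrow> 'o \<Rightarrow> 'o \<Rightarrow> 'm set" where
  "Hom A X Y = {f \<in> Arr A. Src A f = X \<and> Tgt A f = Y}"

definition Hom_group :: "('o, 'm) preadditive_data \<Rightarrow> 'o \<Rightarrow> 'o \<Rightarrow> 'm monoid" where
  "Hom_group A X Y = \<lparr>carrier = Hom A X Y, mult = Add A, one = Zer A X Y\<rparr>"

locale preadditive_category =
  fixes A :: "('o, 'm) preadditive_data" (structure)
  assumes Src_in_Obj: "f \<in> Arr A \<Longrightarrow> Src A f \<in> Obj A"
    and Tgt_in_Obj: "f \<in> Arr A \<Longrightarrow> Tgt A f \<in> Obj A"
    and Idt_in_Hom: "X \<in> Obj A \<Longrightarrow> Idt A X \<in> Hom A X X"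
    and Cmp_in_Hom: "\<lbrakk>f \<in> Hom A X Y; g \<in> Hom A Y Z\<rbrakk> \<Longrightarrow> g \<cdot> f \<in> Hom A X Z"
    and Cmp_assoc:
      "\<lbrakk>f \<in> Hom A W X; g \<in> Hom A X Y; h \<in> Hom A Y Z\<rbrakk> \<Longrightarrow> (h \<cdot> g) \<cdot> f = h \<cdot> (g \<cdot> f)"
    and Cmp_Idt_right: "f \<in> Hom A X Y \<Longrightarrow> f \<cdot> Idt A X = f"
    and Cmp_Idt_left: "f \<in> Hom A X Y \<Longrightarrow> Idt A Y \<cdot> f = f"
    and Hom_comm_group: "\<lbrakk>X \<in> Obj A; Y \<in> Obj A\<rbrakk> \<Longrightarrow> comm_group (Hom_group A X Y)"
    and Cmp_Add_right:
      "\<lbrakk>f \<in> Hom A X Y; f' \<in> Hom A X Y; g \<in> Hom A Y Z\<rbrakk>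
        \<Longrightarrow> g \<cdot> Add A f f' = Add A (g \<cdot> f) (g \<cdot> f')"
    and Cmp_Add_left:
      "\<lbrakk>f \<in> Hom A X Y; g \<in> Hom A Y Z; g' \<in> Hom A Y Z\<rbrakk>
        \<Longrightarrow> Add A g g' \<cdot> f = Add A (g \<cdot> f) (g' \<cdot> f)"

definition is_zero_object :: "('o, 'm) preadditive_data \<Rightarrow> 'o \<Rightarrow> bool" where
  "is_zero_object A Z \<longleftrightarrow>
    Z \<in> Obj A \<and> (\<forall>X \<in> Obj A. (\<exists>!f. f \<in> Hom A X Z) \<and> (\<exists>!f. f \<in> Hom A Z X))"

definition is_mono :: "('o, 'm) preadditive_data \<Rightarrow> 'm \<Rightarrow> bool" where
  "is_mono A f \<longleftrightarrow> f \<in> Arr A \<and>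
    (\<forall>W. \<forall>u \<in> Hom A W (Src A f). \<forall>v \<in> Hom A W (Src A f). f \<cdot>\<^bsub>A\<^esub> u = f \<cdot>\<^bsub>A\<^esub> v \<longrightarrow> u = v)"

definition is_epi :: "('o, 'm) preadditive_data \<Rightarrow> 'm \<Rightarrow> bool" where
  "is_epi A f \<longleftrightarrow> f \<in> Arr A \<and>
    (\<forall>W. \<forall>u \<in> Hom A (Tgt A f) W. \<forall>v \<in> Hom A (Tgt A f) W. u \<cdot>\<^bsub>A\<^esub> f = v \<cdot>\<^bsub>A\<^esub> f \<longrightarrow> u = v)"

definition isomorphic :: "('o, 'm) preadditive_data \<Rightarrow> 'o \<Rightarrow> 'o \<Rightarrow> bool" where
  "isomorphic A X Y \<longleftrightarrow> X \<in> Obj A \<and> Y \<in> Obj A \<and>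
    (\<exists>f \<in> Hom A X Y. \<exists>g \<in> Hom A Y X. g \<cdot>\<^bsub>A\<^esub> f = Idt A X \<and> f \<cdot>\<^bsub>A\<^esub> g = Idt A Y)"

definition is_kernel :: "('o, 'm) preadditive_data \<Rightarrow> 'm \<Rightarrow> 'm \<Rightarrow> bool" where
  "is_kernel A k f \<longleftrightarrow> k \<in> Arr A \<and> f \<in> Arr A \<and> Tgt A k = Src A f \<and>
    f \<cdot>\<^bsub>A\<^esub> k = Zer A (Src A k) (Tgt A f) \<and>
    (\<forall>W. \<forall>u \<in> Hom A W (Src A f). f \<cdot>\<^bsub>A\<^esub> u = Zer A W (Tgt A f) \<longrightarrow>
      (\<exists>!v. v \<in> Hom A W (Src A k) \<and> k \<cdot>\<^bsub>A\<^esub> v = u))"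

definition is_cokernel :: "('o, 'm) preadditive_data \<Rightarrow> 'm \<Rightarrow> 'm \<Rightarrow> bool" where
  "is_cokernel A c f \<longleftrightarrow> c \<in> Arr A \<and> f \<in> Arr A \<and> Src A c = Tgt A f \<and>
    c \<cdot>\<^bsub>A\<^esub> f = Zer A (Src A f) (Tgt A c) \<and>
    (\<forall>W. \<forall>u \<in> Hom A (Tgt A f) W. u \<cdot>\<^bsub>A\<^esub> f = Zer A (Src A f) W \<longrightarrow>
      (\<exists>!v. v \<in> Hom A (Tgt A c) W \<and> v \<cdot>\<^bsub>A\<^esub> c = u))"

definition is_biproduct ::
  "('o, 'm) preadditive_data \<Rightarrow> 'o \<Rightarrow> 'o \<Rightarrow> 'o \<Rightarrow> bool" where
  "is_biproduct A X Y S \<longleftrightarrow> X \<in> Obj A \<and> Y \<in> Obj A \<and> S \<in> Obj A \<and>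
    (\<exists>i \<in> Hom A X S. \<exists>j \<in> Hom A Y S. \<exists>p \<in> Hom A S X. \<exists>q \<in> Hom A S Y.
      p \<cdot>\<^bsub>A\<^esub> i = Idt A X \<and> q \<cdot>\<^bsub>A\<^esub> j = Idt A Y \<and>
      q \<cdot>\<^bsub>A\<^esub> i = Zer A X Y \<and> p \<cdot>\<^bsub>A\<^esub> j = Zer A Y X \<and>
      Add A (i \<cdot>\<^bsub>A\<^esub> p) (j \<cdot>\<^bsub>A\<^esub> q) = Idt A S)"

locale abelian_category = preadditive_category +
  assumes ex_zero_object: "\<exists>Z. is_zero_object A Z"
    and ex_biproduct: "\<lbrakk>X \<in> Obj A; Y \<in> Obj A\<rbrakk> \<Longrightarrow> \<exists>S. is_biproduct A X Y S"
    and ex_kernel: "f \<in> Arr A \<Longrightarrow> \<exists>k. is_kernel A k f"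
    and ex_cokernel: "f \<in> Arr A \<Longrightarrow> \<exists>c. is_cokernel A c f"
    and mono_is_kernel: "is_mono A f \<Longrightarrow> \<exists>g. is_kernel A f g"
    and epi_is_cokernel: "is_epi A f \<Longrightarrow> \<exists>g. is_cokernel A f g"

text \<open>An image of \<open>f\<close>, as a subobject of its target, is a kernel of a cokernel of \<open>f\<close>;
  the object \<open>Im f\<close> is the source of such an \<open>m\<close>.\<close>

definition is_image :: "('o, 'm) preadditive_data \<Rightarrow> 'm \<Rightarrow> 'm \<Rightarrow> bool" where
  "is_image A m f \<longleftrightarrow> (\<exists>c. is_cokernel A c f \<and> is_kernel A m c)"

text \<open>Exactness of \<open>X \<rightarrow> Y \<rightarrow> Z\<close> at \<open>Y\<close>: image and kernel are the same subobject of \<open>Y\<close>.\<close>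

definition exact_at :: "('o, 'm) preadditive_data \<Rightarrow> 'm \<Rightarrow> 'm \<Rightarrow> bool" where
  "exact_at A f g \<longleftrightarrow> f \<in> Arr A \<and> g \<in> Arr A \<and> Tgt A f = Src A g \<and>
    (\<exists>m. is_image A m f \<and> is_kernel A m g)"

definition exact_list :: "('o, 'm) preadditive_data \<Rightarrow> 'm list \<Rightarrow> bool" where
  "exact_list A fs \<longleftrightarrow> (\<forall>i. Suc i < length fs \<longrightarrow> exact_at A (fs ! i) (fs ! Suc i))"

text \<open>An \<open>n\<close>-extension of \<open>X\<close> by \<open>Y\<close> is an exact sequence
  \<open>0 \<rightarrow> Y \<rightarrow> E\<^sub>1 \<rightarrow> \<dots> \<rightarrow> E\<^sub>n \<rightarrow> X \<rightarrow> 0\<close>, given by the list of its \<open>n + 1\<close> arrows between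
  \<open>Y\<close> and \<open>X\<close>.\<close>

definition is_extension ::
  "('o, 'm) preadditive_data \<Rightarrow> nat \<Rightarrow> 'o \<Rightarrow> 'o \<Rightarrow> 'm list \<Rightarrow> bool" where
  "is_extension A n X Y es \<longleftrightarrow> length es = Suc n \<and>
    Src A (hd es) = Y \<and> Tgt A (last es) = X \<and>
    (\<exists>Z. is_zero_object A Z \<and> exact_list A (Zer A Z Y # es @ [Zer A X Z]))"

text \<open>Morphisms of \<open>n\<close>-extensions are the identity on both ends.\<close>

definition ext_morphism ::
  "('o, 'm) preadditive_data \<Rightarrow> nat \<Rightarrow> 'o \<Rightarrow> 'o \<Rightarrow> 'm list \<Rightarrow> 'm list \<Rightarrow> bool" where
  "ext_morphism A n X Y es es' \<longleftrightarrow> is_extension A n X Y es \<and> is_extension A n X Y es' \<and>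
    (\<exists>\<phi> :: nat \<Rightarrow> 'm. \<phi> 0 = Idt A Y \<and> \<phi> (Suc n) = Idt A X \<and>
      (\<forall>i \<le> n. \<phi> i \<in> Hom A (Src A (es ! i)) (Src A (es' ! i)) \<and>
        \<phi> (Suc i) \<in> Hom A (Tgt A (es ! i)) (Tgt A (es' ! i)) \<and>
        \<phi> (Suc i) \<cdot>\<^bsub>A\<^esub> (es ! i) = (es' ! i) \<cdot>\<^bsub>A\<^esub> \<phi> i))"

text \<open>Yoneda Ext, available without enough projectives or injectives: \<open>n\<close>-extensions modulo the
  equivalence relation generated by their morphisms, for \<open>n \<ge> 1\<close>.\<close>

definition Ext :: "('o, 'm) preadditive_data \<Rightarrow> nat \<Rightarrow> 'o \<Rightarrow> 'o \<Rightarrow> 'm list set set" where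
  "Ext A n X Y = {es. is_extension A n X Y es} //
    {(es, es'). ext_morphism A n X Y es es' \<or> ext_morphism A n X Y es' es}\<^sup>*"

text \<open>A group is zero iff its underlying set is a singleton, so the Baer sum is not needed to
  say that Ext vanishes.\<close>

definition Ext_vanishes :: "('o, 'm) preadditive_data \<Rightarrow> nat \<Rightarrow> 'o \<Rightarrow> 'o \<Rightarrow> bool" where
  "Ext_vanishes A n X Y \<longleftrightarrow> is_singleton (Ext A n X Y)"

text \<open>Full additive subcategories closed under isomorphisms are given by their sets of objects.\<close>

definition is_subcategory :: "('o, 'm) preadditive_data \<Rightarrow> 'o set \<Rightarrow> bool" where
  "is_subcategory A C \<longleftrightarrow> C \<subseteq> Obj A \<and>
    (\<exists>Z \<in> C. is_zero_object A Z) \<and>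
    (\<forall>X \<in> C. \<forall>Y \<in> C. \<exists>S \<in> C. is_biproduct A X Y S) \<and>
    (\<forall>X \<in> C. \<forall>Y. isomorphic A X Y \<longrightarrow> Y \<in> C)"

definition closed_under_summands :: "('o, 'm) preadditive_data \<Rightarrow> 'o set \<Rightarrow> bool" where
  "closed_under_summands A C \<longleftrightarrow> (\<forall>M N S. is_biproduct A M N S \<and> S \<in> C \<longrightarrow> M \<in> C)"

definition is_projective :: "('o, 'm) preadditive_data \<Rightarrow> 'o \<Rightarrow> bool" where
  "is_projective A P \<longleftrightarrow> P \<in> Obj A \<and>
    (\<forall>e. is_epi A e \<longrightarrow> (\<forall>f \<in> Hom A P (Tgt A e). \<exists>g \<in> Hom A P (Src A e). e \<cdot>\<^bsub>A\<^esub> g = f))"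

definition projectives :: "('o, 'm) preadditive_data \<Rightarrow> 'o set" where
  "projectives A = {P. is_projective A P}"

definition Ext_orthogonal :: "('o, 'm) preadditive_data \<Rightarrow> 'o set \<Rightarrow> 'o set \<Rightarrow> bool" where
  "Ext_orthogonal A \<X> \<Y> \<longleftrightarrow> (\<forall>i \<ge> 1. \<forall>X \<in> \<X>. \<forall>Y \<in> \<Y>. Ext_vanishes A i X Y)"

definition right_perp1 :: "('o, 'm) preadditive_data \<Rightarrow> 'o set \<Rightarrow> 'o set" where
  "right_perp1 A \<X> = {M \<in> Obj A. \<forall>X \<in> \<X>. Ext_vanishes A 1 X M}"

definition is_generator :: "('o, 'm) preadditive_data \<Rightarrow> 'o set \<Rightarrow> 'o set \<Rightarrow> bool" where
  "is_generator A \<X> \<T> \<longleftrightarrow> \<X> \<subseteq> \<T> \<and>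
    (\<forall>T \<in> \<T>. \<exists>T' \<in> \<T>. \<exists>X \<in> \<X>. \<exists>f \<in> Hom A T' X. \<exists>g \<in> Hom A X T. is_extension A 1 T T' [f, g])"

definition is_projective_generator ::
  "('o, 'm) preadditive_data \<Rightarrow> 'o set \<Rightarrow> 'o set \<Rightarrow> bool" where
  "is_projective_generator A \<X> \<T> \<longleftrightarrow> is_generator A \<X> \<T> \<and> Ext_orthogonal A \<X> \<T>"

text \<open>A sequence infinite in both directions is a family \<open>d\<close> of arrows indexed by the integers
  with \<open>Tgt (d n) = Src (d (n + 1))\<close>.\<close>

definition is_exact_sequence :: "('o, 'm) preadditive_data \<Rightarrow> (int \<Rightarrow> 'm) \<Rightarrow> bool" where
  "is_exact_sequence A d \<longleftrightarrow> (\<forall>n. exact_at A (d n) (d (n + 1)))"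

definition Hom_from_exact ::
  "('o, 'm) preadditive_data \<Rightarrow> 'o set \<Rightarrow> (int \<Rightarrow> 'm) \<Rightarrow> bool" where
  "Hom_from_exact A \<X> d \<longleftrightarrow> (\<forall>X \<in> \<X>. \<forall>n.
    (\<lambda>h. d n \<cdot>\<^bsub>A\<^esub> h) ` carrier (Hom_group A X (Src A (d n))) =
    kernel (Hom_group A X (Src A (d (n + 1)))) (Hom_group A X (Tgt A (d (n + 1))))
      (\<lambda>h. d (n + 1) \<cdot>\<^bsub>A\<^esub> h))"

definition Hom_to_exact ::
  "('o, 'm) preadditive_data \<Rightarrow> 'o set \<Rightarrow> (int \<Rightarrow> 'm) \<Rightarrow> bool" where
  "Hom_to_exact A \<X> d \<longleftrightarrow> (\<forall>X \<in> \<X>. \<forall>n.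
    (\<lambda>h. h \<cdot>\<^bsub>A\<^esub> d (n + 1)) ` carrier (Hom_group A (Tgt A (d (n + 1))) X) =
    kernel (Hom_group A (Tgt A (d n)) X) (Hom_group A (Src A (d n)) X)
      (\<lambda>h. h \<cdot>\<^bsub>A\<^esub> d n))"

text \<open>The arrow \<open>d 0\<close> is the one written \<open>C\<^sub>0 \<rightarrow> C\<^sup>0\<close>.\<close>

definition Gorenstein :: "('o, 'm) preadditive_data \<Rightarrow> 'o set \<Rightarrow> 'o set" where
  "Gorenstein A C = {M \<in> Obj A. \<exists>d. is_exact_sequence A d \<and> (\<forall>n. Src A (d n) \<in> C) \<and>
    Hom_from_exact A C d \<and> Hom_to_exact A C d \<and>
    (\<exists>m. is_image A m (d 0) \<and> isomorphic A M (Src A m))}"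

end

theory Submission
  imports Defs
begin

text \<open>
  An object \<open>X\<close> of \<open>\<C>\<close> is the image of the middle arrow of the contractible sequence
  \<open>\<dots> \<rightarrow> 0 \<rightarrow> X = X \<rightarrow> 0 \<rightarrow> \<dots>\<close>, so \<open>\<C> \<subseteq> \<G>(\<C>)\<close>. Conversely, if \<open>M\<close> is the image of \<open>d 0\<close> in a
  sequence \<open>d\<close> as in the definition of \<open>\<G>(\<C>)\<close>, then so is the image \<open>N\<close> of \<open>d 1\<close> (shift \<open>d\<close>), and
  there is a short exact sequence \<open>0 \<rightarrow> M \<rightarrow> E \<rightarrow> N \<rightarrow> 0\<close> with \<open>E\<close> in \<open>\<C>\<close>. If \<open>Ext\<^sup>1(N, M) = 0\<close> it
  splits, and \<open>M\<close> is a direct summand of \<open>E\<close>. For the Yoneda \<open>Ext\<^sup>1\<close>, this splitting amounts to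
  the invariance of split extensions under the equivalence generated by morphisms of
  extensions: retractions pull back and sections push forward along a morphism.
\<close>

section \<open>Preadditive categories\<close>

lemma Hom_Arr: "f \<in> Hom A X Y \<Longrightarrow> f \<in> Arr A"
  and Hom_Src: "f \<in> Hom A X Y \<Longrightarrow> Src A f = X"
  and Hom_Tgt: "f \<in> Hom A X Y \<Longrightarrow> Tgt A f = Y"
  and Arr_Hom: "f \<in> Arr A \<Longrightarrow> f \<in> Hom A (Src A f) (Tgt A f)"
  by (auto simp: Hom_def)

context preadditive_category
begin

lemma Hom_Obj: "f \<in> Hom A X Y \<Longrightarrow> X \<in> Obj A" "f \<in> Hom A X Y \<Longrightarrow> Y \<in> Obj A"
  using Src_in_Obj Tgt_in_Obj by (auto simp: Hom_def)

section \<open>Zero arrows and subtraction in the Hom groups\<close>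

lemma Zer_in_Hom: "\<lbrakk>X \<in> Obj A; Y \<in> Obj A\<rbrakk> \<Longrightarrow> Zer A X Y \<in> Hom A X Y"
  using monoid.one_closed[OF group.is_monoid[OF comm_group.axioms(2)[OF Hom_comm_group]], of X Y]
  by (simp add: Hom_group_def)

lemma Add_Zer_left: "f \<in> Hom A X Y \<Longrightarrow> Add A (Zer A X Y) f = f"
  using monoid.l_one[OF group.is_monoid[OF comm_group.axioms(2)[OF Hom_comm_group]], of X Y f]
    Hom_Obj
  by (auto simp: Hom_group_def)

lemma Add_Zer_right: "f \<in> Hom A X Y \<Longrightarrow> Add A f (Zer A X Y) = f"
  using monoid.r_one[OF group.is_monoid[OF comm_group.axioms(2)[OF Hom_comm_group]], of X Y f]
    Hom_Obj
  by (auto simp: Hom_group_def)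

lemma Add_right_cancel:
  assumes "f \<in> Hom A X Y" "g \<in> Hom A X Y" "h \<in> Hom A X Y" "Add A f h = Add A g h"
  shows "f = g"
  using group.right_cancel[OF comm_group.axioms(2)[OF Hom_comm_group], of X Y h f g]
    Hom_Obj[OF assms(1)] assms
  by (auto simp: Hom_group_def)

lemma Add_eq_right:
  assumes "f \<in> Hom A X Y" "h \<in> Hom A X Y" "Add A f h = h"
  shows "f = Zer A X Y"
  using Add_right_cancel[OF assms(1) Zer_in_Hom assms(2)] Hom_Obj[OF assms(1)]
    Add_Zer_left[OF assms(2)] assms(3) by simp

text \<open>The record provides no negation, so the difference of two parallel arrows is
  characterised by \<open>Add A h g = f\<close>. Later arguments then work with addition and
  cancellation alone.\<close>

lemma difference_exists:
  assumes "f \<in> Hom A X Y" "g \<in> Hom A X Y"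
  obtains h where "h \<in> Hom A X Y" "Add A h g = f"
proof -
  interpret G: comm_group "Hom_group A X Y" using Hom_comm_group Hom_Obj[OF assms(1)] by blast
  have c: "f \<in> carrier (Hom_group A X Y)" "g \<in> carrier (Hom_group A X Y)"
    using assms by (auto simp: Hom_group_def)
  let ?h = "f \<otimes>\<^bsub>Hom_group A X Y\<^esub> inv\<^bsub>Hom_group A X Y\<^esub> g"
  have "?h \<in> carrier (Hom_group A X Y)" "?h \<otimes>\<^bsub>Hom_group A X Y\<^esub> g = f"
    using c by (simp_all add: G.m_assoc)
  then show thesis using that by (auto simp: Hom_group_def)
qed

text \<open>Bilinearity makes the composite equal to its own double, and cancellation leaves
  zero.\<close>

lemma Cmp_Zer_right:
  assumes "g \<in> Hom A Y Z" "X \<in> Obj A"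
  shows "g \<cdot> Zer A X Y = Zer A X Z"
proof -
  have z: "Zer A X Y \<in> Hom A X Y" using Zer_in_Hom assms Hom_Obj by blast
  then have "g \<cdot> Zer A X Y \<in> Hom A X Z" using Cmp_in_Hom assms by blast
  moreover have "Add A (g \<cdot> Zer A X Y) (g \<cdot> Zer A X Y) = g \<cdot> Zer A X Y"
    using Cmp_Add_right[OF z z assms(1)] Add_Zer_left[OF z] by simp
  ultimately show ?thesis using Add_eq_right by blast
qed

lemma Cmp_Zer_left:
  assumes "f \<in> Hom A X Y" "Z \<in> Obj A"
  shows "Zer A Y Z \<cdot> f = Zer A X Z"
proof -
  have z: "Zer A Y Z \<in> Hom A Y Z" using Zer_in_Hom assms Hom_Obj by blast
  then have "Zer A Y Z \<cdot> f \<in> Hom A X Z" using Cmp_in_Hom assms by blast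
  moreover have "Add A (Zer A Y Z \<cdot> f) (Zer A Y Z \<cdot> f) = Zer A Y Z \<cdot> f"
    using Cmp_Add_left[OF assms(1) z z] Add_Zer_left[OF z] by simp
  ultimately show ?thesis using Add_eq_right by blast
qed

lemma zero_object_Obj: "is_zero_object A Z \<Longrightarrow> Z \<in> Obj A"
  by (simp add: is_zero_object_def)

lemma Hom_to_zero_object:
  assumes "is_zero_object A Z" "f \<in> Hom A X Z"
  shows "f = Zer A X Z"
  using assms Hom_Obj Zer_in_Hom unfolding is_zero_object_def by metis

lemma Hom_from_zero_object:
  assumes "is_zero_object A Z" "f \<in> Hom A Z X"
  shows "f = Zer A Z X"
  using assms Hom_Obj Zer_in_Hom unfolding is_zero_object_def by metis

lemma isomorphic_refl: "X \<in> Obj A \<Longrightarrow> isomorphic A X X"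
  unfolding isomorphic_def using Idt_in_Hom Cmp_Idt_left by blast

lemma isomorphic_sym: "isomorphic A X Y \<Longrightarrow> isomorphic A Y X"
  unfolding isomorphic_def by blast

section \<open>Monomorphisms, epimorphisms, kernels and cokernels\<close>

text \<open>Two arrows that \<open>f\<close> identifies have a difference killed by
  \<open>f\<close>, so it suffices to test against zero.\<close>

lemma monoI:
  assumes f: "f \<in> Hom A X Y"
    and inj: "\<And>W u. \<lbrakk>u \<in> Hom A W X; f \<cdot> u = Zer A W Y\<rbrakk> \<Longrightarrow> u = Zer A W X"
  shows "is_mono A f"
  unfolding is_mono_def
proof (intro conjI allI ballI impI)
  show "f \<in> Arr A" using f by (rule Hom_Arr)
  fix W u v assume "u \<in> Hom A W (Src A f)" "v \<in> Hom A W (Src A f)" and eq: "f \<cdot> u = f \<cdot> v"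
  then have u: "u \<in> Hom A W X" and v: "v \<in> Hom A W X" using f by (simp_all add: Hom_def)
  obtain h where h: "h \<in> Hom A W X" "Add A h v = u" using difference_exists[OF u v] .
  have "Add A (f \<cdot> h) (f \<cdot> v) = f \<cdot> v" using Cmp_Add_right[OF h(1) v f] h(2) eq by simp
  then have "f \<cdot> h = Zer A W Y"
    using Add_eq_right Cmp_in_Hom[OF h(1) f] Cmp_in_Hom[OF v f] by blast
  then have "h = Zer A W X" using inj h by blast
  then show "u = v" using h(2) Add_Zer_left[OF v] by simp
qed

lemma epiI:
  assumes f: "f \<in> Hom A X Y"
    and inj: "\<And>W u. \<lbrakk>u \<in> Hom A Y W; u \<cdot> f = Zer A X W\<rbrakk> \<Longrightarrow> u = Zer A Y W"
  shows "is_epi A f"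
  unfolding is_epi_def
proof (intro conjI allI ballI impI)
  show "f \<in> Arr A" using f by (rule Hom_Arr)
  fix W u v assume "u \<in> Hom A (Tgt A f) W" "v \<in> Hom A (Tgt A f) W" and eq: "u \<cdot> f = v \<cdot> f"
  then have u: "u \<in> Hom A Y W" and v: "v \<in> Hom A Y W" using f by (simp_all add: Hom_def)
  obtain h where h: "h \<in> Hom A Y W" "Add A h v = u" using difference_exists[OF u v] .
  have "Add A (h \<cdot> f) (v \<cdot> f) = v \<cdot> f" using Cmp_Add_left[OF f h(1) v] h(2) eq by simp
  then have "h \<cdot> f = Zer A X W"
    using Add_eq_right Cmp_in_Hom[OF f h(1)] Cmp_in_Hom[OF f v] by blast
  then have "h = Zer A Y W" using inj h by blast
  then show "u = v" using h(2) Add_Zer_left[OF v] by simp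
qed

lemma mono_cancel:
  assumes "is_mono A f" "f \<in> Hom A X Y" "u \<in> Hom A W X" "v \<in> Hom A W X" "f \<cdot> u = f \<cdot> v"
  shows "u = v"
  using assms Hom_Src[OF assms(2)] unfolding is_mono_def by blast

lemma epi_cancel:
  assumes "is_epi A f" "f \<in> Hom A X Y" "u \<in> Hom A Y W" "v \<in> Hom A Y W" "u \<cdot> f = v \<cdot> f"
  shows "u = v"
  using assms Hom_Tgt[OF assms(2)] unfolding is_epi_def by blast

lemma mono_zero:
  assumes "is_mono A f" "f \<in> Hom A X Y" "u \<in> Hom A W X" "f \<cdot> u = Zer A W Y"
  shows "u = Zer A W X"
  using mono_cancel[OF assms(1-3) Zer_in_Hom] Cmp_Zer_right Hom_Obj assms by metis

lemma epi_zero: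
  assumes "is_epi A f" "f \<in> Hom A X Y" "u \<in> Hom A Y W" "u \<cdot> f = Zer A X W"
  shows "u = Zer A Y W"
  using epi_cancel[OF assms(1-3) Zer_in_Hom] Cmp_Zer_left Hom_Obj assms by metis

text \<open>Monicity of \<open>k\<close> supplies uniqueness of the factorisation, which leaves only
  existence to be checked.\<close>

lemma kernelI:
  assumes k: "k \<in> Hom A K X" and f: "f \<in> Hom A X Y" and "is_mono A k" and "f \<cdot> k = Zer A K Y"
    and lift: "\<And>W u. \<lbrakk>u \<in> Hom A W X; f \<cdot> u = Zer A W Y\<rbrakk> \<Longrightarrow> \<exists>v \<in> Hom A W K. k \<cdot> v = u"
  shows "is_kernel A k f"
proof -
  have "\<exists>!v. v \<in> Hom A W K \<and> k \<cdot> v = u" if "u \<in> Hom A W X" "f \<cdot> u = Zer A W Y" for W u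
    using lift[OF that] mono_cancel[OF assms(3) k] by blast
  then show ?thesis
    unfolding is_kernel_def
    using assms(4) Hom_Arr[OF k] Hom_Arr[OF f] Hom_Src[OF k] Hom_Src[OF f] Hom_Tgt[OF k] Hom_Tgt[OF f]
    by simp
qed

lemma cokernelI:
  assumes c: "c \<in> Hom A Y Q" and f: "f \<in> Hom A X Y" and "is_epi A c" and "c \<cdot> f = Zer A X Q"
    and desc: "\<And>W u. \<lbrakk>u \<in> Hom A Y W; u \<cdot> f = Zer A X W\<rbrakk> \<Longrightarrow> \<exists>v \<in> Hom A Q W. v \<cdot> c = u"
  shows "is_cokernel A c f"
proof -
  have "\<exists>!v. v \<in> Hom A Q W \<and> v \<cdot> c = u" if "u \<in> Hom A Y W" "u \<cdot> f = Zer A X W" for W u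
    using desc[OF that] epi_cancel[OF assms(3) c] by blast
  then show ?thesis
    unfolding is_cokernel_def
    using assms(4) Hom_Arr[OF c] Hom_Arr[OF f] Hom_Src[OF c] Hom_Src[OF f] Hom_Tgt[OF c] Hom_Tgt[OF f]
    by simp
qed

lemma kernel_Hom:
  assumes "is_kernel A k f" "f \<in> Hom A X Y"
  shows "k \<in> Hom A (Src A k) X"
  using assms unfolding is_kernel_def Hom_def by auto

lemma cokernel_Hom:
  assumes "is_cokernel A c f" "f \<in> Hom A X Y"
  shows "c \<in> Hom A Y (Tgt A c)"
  using assms unfolding is_cokernel_def Hom_def by auto

lemma kernel_zero:
  assumes "is_kernel A k f" "k \<in> Hom A K X" "f \<in> Hom A X Y"
  shows "f \<cdot> k = Zer A K Y"
  using assms unfolding is_kernel_def Hom_def by auto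

lemma cokernel_zero:
  assumes "is_cokernel A c f" "c \<in> Hom A Y Q" "f \<in> Hom A X Y"
  shows "c \<cdot> f = Zer A X Q"
  using assms unfolding is_cokernel_def Hom_def by auto

lemma kernel_lift:
  assumes "is_kernel A k f" "k \<in> Hom A K X" "f \<in> Hom A X Y"
    and "u \<in> Hom A W X" "f \<cdot> u = Zer A W Y"
  obtains v where "v \<in> Hom A W K" "k \<cdot> v = u"
  using assms Hom_Src[OF assms(2)] Hom_Src[OF assms(3)] Hom_Tgt[OF assms(3)]
  unfolding is_kernel_def by metis

lemma cokernel_desc:
  assumes "is_cokernel A c f" "c \<in> Hom A Y Q" "f \<in> Hom A X Y"
    and "u \<in> Hom A Y W" "u \<cdot> f = Zer A X W"
  obtains v where "v \<in> Hom A Q W" "v \<cdot> c = u"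
  using assms Hom_Tgt[OF assms(2)] Hom_Src[OF assms(3)] Hom_Tgt[OF assms(3)]
  unfolding is_cokernel_def by metis

text \<open>If \<open>k\<close> kills \<open>u\<close>, then \<open>u\<close> and the zero arrow
  both factor the same zero arrow through \<open>k\<close>, so they agree.\<close>

lemma kernel_mono:
  assumes "is_kernel A k f"
  shows "is_mono A k"
proof -
  have f: "f \<in> Hom A (Src A f) (Tgt A f)" using assms Arr_Hom by (auto simp: is_kernel_def)
  have k: "k \<in> Hom A (Src A k) (Src A f)" using kernel_Hom[OF assms f] .
  show ?thesis
  proof (rule monoI[OF k])
    fix W u assume u: "u \<in> Hom A W (Src A k)" and 0: "k \<cdot> u = Zer A W (Src A f)"
    have W: "W \<in> Obj A" using Hom_Obj u by blast
    have z: "Zer A W (Src A k) \<in> Hom A W (Src A k)" "k \<cdot> Zer A W (Src A k) = Zer A W (Src A f)"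
      using Zer_in_Hom W Cmp_Zer_right k Hom_Obj by blast+
    have "Zer A W (Src A f) \<in> Hom A W (Src A f)" "f \<cdot> Zer A W (Src A f) = Zer A W (Tgt A f)"
      using Zer_in_Hom W Cmp_Zer_right f Hom_Obj by blast+
    then have "\<exists>!v. v \<in> Hom A W (Src A k) \<and> k \<cdot> v = Zer A W (Src A f)"
      using assms unfolding is_kernel_def by blast
    then show "u = Zer A W (Src A k)" using u 0 z by blast
  qed
qed

lemma cokernel_epi:
  assumes "is_cokernel A c f"
  shows "is_epi A c"
proof -
  have f: "f \<in> Hom A (Src A f) (Tgt A f)" using assms Arr_Hom by (auto simp: is_cokernel_def)
  have c: "c \<in> Hom A (Tgt A f) (Tgt A c)" using cokernel_Hom[OF assms f] .
  show ?thesis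
  proof (rule epiI[OF c])
    fix W u assume u: "u \<in> Hom A (Tgt A c) W" and 0: "u \<cdot> c = Zer A (Tgt A f) W"
    have W: "W \<in> Obj A" using Hom_Obj u by blast
    have z: "Zer A (Tgt A c) W \<in> Hom A (Tgt A c) W" "Zer A (Tgt A c) W \<cdot> c = Zer A (Tgt A f) W"
      using Zer_in_Hom W Cmp_Zer_left c Hom_Obj by blast+
    have "Zer A (Tgt A f) W \<in> Hom A (Tgt A f) W" "Zer A (Tgt A f) W \<cdot> f = Zer A (Src A f) W"
      using Zer_in_Hom W Cmp_Zer_left f Hom_Obj by blast+
    then have "\<exists>!v. v \<in> Hom A (Tgt A c) W \<and> v \<cdot> c = Zer A (Tgt A f) W"
      using assms unfolding is_cokernel_def by blast
    then show "u = Zer A (Tgt A c) W" using u 0 z by blast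
  qed
qed

text \<open>A kernel depends only on which arrows are annihilated. This recognises a kernel of one
  arrow as a kernel of another without constructing comparison isomorphisms.\<close>

lemma kernel_transfer:
  assumes ker: "is_kernel A k f" and f: "f \<in> Hom A X Y" and g: "g \<in> Hom A X Z"
    and same: "\<And>W u. u \<in> Hom A W X \<Longrightarrow> f \<cdot> u = Zer A W Y \<longleftrightarrow> g \<cdot> u = Zer A W Z"
  shows "is_kernel A k g"
proof -
  have k: "k \<in> Hom A (Src A k) X" using kernel_Hom[OF ker f] .
  show ?thesis
  proof (rule kernelI[OF k g kernel_mono[OF ker]])
    show "g \<cdot> k = Zer A (Src A k) Z" using kernel_zero[OF ker k f] same[OF k] by simp
    show "\<exists>v \<in> Hom A W (Src A k). k \<cdot> v = u" if "u \<in> Hom A W X" "g \<cdot> u = Zer A W Z" for W u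
      using kernel_lift[OF ker k f that(1)] same that by blast
  qed
qed

section \<open>Split arrows, zero arrows, and exactness next to a zero object\<close>

lemma split_mono:
  assumes "f \<in> Hom A X Y" "r \<in> Hom A Y X" "r \<cdot> f = Idt A X"
  shows "is_mono A f"
proof (rule monoI[OF assms(1)])
  fix W u assume u: "u \<in> Hom A W X" "f \<cdot> u = Zer A W Y"
  show "u = Zer A W X"
    using Cmp_assoc[OF u(1) assms(1,2)] u(2) assms(3) Cmp_Idt_left[OF u(1)]
      Cmp_Zer_right[OF assms(2) Hom_Obj(1)[OF u(1)]] by simp
qed

lemma split_epi:
  assumes "f \<in> Hom A X Y" "s \<in> Hom A Y X" "f \<cdot> s = Idt A Y"
  shows "is_epi A f"
proof (rule epiI[OF assms(1)])
  fix W u assume u: "u \<in> Hom A Y W" "u \<cdot> f = Zer A X W"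
  show "u = Zer A Y W"
    using Cmp_assoc[OF assms(2,1) u(1)] u(2) assms(3) Cmp_Idt_right[OF u(1)]
      Cmp_Zer_left[OF assms(2) Hom_Obj(2)[OF u(1)]] by simp
qed

lemma kernel_Zer:
  assumes "X \<in> Obj A" "Y \<in> Obj A"
  shows "is_kernel A (Idt A X) (Zer A X Y)"
proof (rule kernelI)
  show i: "Idt A X \<in> Hom A X X" and "Zer A X Y \<in> Hom A X Y" using assms Idt_in_Hom Zer_in_Hom by blast+
  show "is_mono A (Idt A X)" using split_mono[OF i i] Cmp_Idt_left i by blast
  show "Zer A X Y \<cdot> Idt A X = Zer A X Y" using Cmp_Zer_left i assms by blast
qed (use Cmp_Idt_left in blast)

lemma cokernel_Zer:
  assumes "X \<in> Obj A" "Y \<in> Obj A"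
  shows "is_cokernel A (Idt A Y) (Zer A X Y)"
proof (rule cokernelI)
  show i: "Idt A Y \<in> Hom A Y Y" and "Zer A X Y \<in> Hom A X Y" using assms Idt_in_Hom Zer_in_Hom by blast+
  show "is_epi A (Idt A Y)" using split_epi[OF i i] Cmp_Idt_left i by blast
  show "Idt A Y \<cdot> Zer A X Y = Zer A X Y" using Cmp_Zer_right i assms by blast
qed (use Cmp_Idt_right in blast)

lemma mono_kernel_zero_object:
  assumes Z: "is_zero_object A Z" and f: "f \<in> Hom A X Y" "is_mono A f"
  shows "is_kernel A (Zer A Z X) f"
proof (rule kernelI[OF _ f(1)])
  have O: "Z \<in> Obj A" "X \<in> Obj A" using Z f Hom_Obj zero_object_Obj by blast+
  then show z: "Zer A Z X \<in> Hom A Z X" using Zer_in_Hom by blast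
  show "is_mono A (Zer A Z X)" using monoI[OF z] Hom_to_zero_object[OF Z] by blast
  show "f \<cdot> Zer A Z X = Zer A Z Y" using Cmp_Zer_right f O by blast
  fix W u assume u: "u \<in> Hom A W X" "f \<cdot> u = Zer A W Y"
  then have W: "W \<in> Obj A" and "u = Zer A W X" using Hom_Obj mono_zero f by blast+
  then have "Zer A Z X \<cdot> Zer A W Z = u" using Cmp_Zer_right z by simp
  then show "\<exists>v \<in> Hom A W Z. Zer A Z X \<cdot> v = u" using Zer_in_Hom W O by blast
qed

lemma epi_cokernel_zero_object:
  assumes Z: "is_zero_object A Z" and f: "f \<in> Hom A X Y" "is_epi A f"
  shows "is_cokernel A (Zer A Y Z) f"
proof (rule cokernelI[OF _ f(1)])
  have O: "Z \<in> Obj A" "Y \<in> Obj A" using Z f Hom_Obj zero_object_Obj by blast+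
  then show z: "Zer A Y Z \<in> Hom A Y Z" using Zer_in_Hom by blast
  show "is_epi A (Zer A Y Z)" using epiI[OF z] Hom_from_zero_object[OF Z] by blast
  show "Zer A Y Z \<cdot> f = Zer A X Z" using Cmp_Zer_left f O by blast
  fix W u assume u: "u \<in> Hom A Y W" "u \<cdot> f = Zer A X W"
  then have W: "W \<in> Obj A" and "u = Zer A Y W" using Hom_Obj epi_zero f by blast+
  then have "Zer A Z W \<cdot> Zer A Y Z = u" using Cmp_Zer_left z by simp
  then show "\<exists>v \<in> Hom A Z W. v \<cdot> Zer A Y Z = u" using Zer_in_Hom W O by blast
qed

text \<open>The cokernel of \<open>Zer A Z X\<close> is the identity of \<open>X\<close>, whose
  kernel is \<open>Zer A Z X\<close> again. So this arrow is its own image, and it is also a kernel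
  of the monomorphism \<open>f\<close>.\<close>

lemma exact_at_zero_mono:
  assumes Z: "is_zero_object A Z" and f: "f \<in> Hom A X Y" "is_mono A f"
  shows "exact_at A (Zer A Z X) f"
proof -
  have O: "Z \<in> Obj A" "X \<in> Obj A" using Z f Hom_Obj zero_object_Obj by blast+
  have i: "Idt A X \<in> Hom A X X" "is_mono A (Idt A X)"
    using O Idt_in_Hom kernel_mono kernel_Zer by blast+
  have "is_image A (Zer A Z X) (Zer A Z X)"
    unfolding is_image_def using cokernel_Zer O mono_kernel_zero_object[OF Z i] by blast
  then show ?thesis
    unfolding exact_at_def
    using mono_kernel_zero_object[OF assms] Zer_in_Hom[OF O] f by (auto simp: Hom_def)
qed

text \<open>The cokernel of an epimorphism is zero, and the identity is a kernel of that. The image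
  is recorded separately because it identifies the image of \<open>d 0\<close> in
  \<open>Gorenstein_superset\<close>.\<close>

lemma exact_at_epi_zero:
  assumes Z: "is_zero_object A Z" and f: "f \<in> Hom A X Y" "is_epi A f"
  shows "exact_at A f (Zer A Y Z)" "is_image A (Idt A Y) f"
proof -
  have O: "Z \<in> Obj A" "Y \<in> Obj A" using Z f Hom_Obj zero_object_Obj by blast+
  show "is_image A (Idt A Y) f"
    unfolding is_image_def using kernel_Zer O epi_cokernel_zero_object[OF Z f] by blast
  then show "exact_at A f (Zer A Y Z)"
    unfolding exact_at_def
    using kernel_Zer[OF O(2,1)] Zer_in_Hom[OF O(2,1)] f by (auto simp: Hom_def)
qed

end

section \<open>Exactness in abelian categories\<close>

context abelian_category
begin

text \<open>\<open>f\<close> is a kernel of some \<open>g\<close>, and \<open>g\<close> kills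
  \<open>f\<close>, so it factors through \<open>c\<close>. Whatever \<open>c\<close> kills is then
  killed by \<open>g\<close> and lifts along \<open>f\<close>.\<close>

lemma mono_kernel_of_cokernel:
  assumes "is_mono A f" "is_cokernel A c f"
  shows "is_kernel A f c"
proof -
  have f: "f \<in> Hom A (Src A f) (Tgt A f)" using assms Arr_Hom by (auto simp: is_mono_def)
  have c: "c \<in> Hom A (Tgt A f) (Tgt A c)" using cokernel_Hom[OF assms(2) f] .
  obtain g where ker: "is_kernel A f g" using mono_is_kernel assms by blast
  then have g: "g \<in> Hom A (Tgt A f) (Tgt A g)" unfolding is_kernel_def Hom_def by auto
  obtain v where v: "v \<in> Hom A (Tgt A c) (Tgt A g)" "v \<cdot> c = g"
    using cokernel_desc[OF assms(2) c f g kernel_zero[OF ker f g]] .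
  show ?thesis
  proof (rule kernelI[OF f c assms(1) cokernel_zero[OF assms(2) c f]])
    fix W u assume u: "u \<in> Hom A W (Tgt A f)" "c \<cdot> u = Zer A W (Tgt A c)"
    have "g \<cdot> u = Zer A W (Tgt A g)"
      using Cmp_assoc[OF u(1) c v(1)] v u(2) Cmp_Zer_right[OF v(1)] Hom_Obj(1)[OF u(1)] by simp
    then show "\<exists>v \<in> Hom A W (Src A f). f \<cdot> v = u" using kernel_lift[OF ker f g u(1)] by blast
  qed
qed

lemma epi_cokernel_of_kernel:
  assumes "is_epi A f" "is_kernel A k f"
  shows "is_cokernel A f k"
proof -
  have f: "f \<in> Hom A (Src A f) (Tgt A f)" using assms Arr_Hom by (auto simp: is_epi_def)
  have k: "k \<in> Hom A (Src A k) (Src A f)" using kernel_Hom[OF assms(2) f] .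
  obtain g where cok: "is_cokernel A f g" using epi_is_cokernel assms by blast
  then have g: "g \<in> Hom A (Src A g) (Src A f)" unfolding is_cokernel_def Hom_def by auto
  obtain v where v: "v \<in> Hom A (Src A g) (Src A k)" "k \<cdot> v = g"
    using kernel_lift[OF assms(2) k f g cokernel_zero[OF cok f g]] .
  show ?thesis
  proof (rule cokernelI[OF f k assms(1) kernel_zero[OF assms(2) k f]])
    fix W u assume u: "u \<in> Hom A (Src A f) W" "u \<cdot> k = Zer A (Src A k) W"
    have "u \<cdot> g = Zer A (Src A g) W"
      using Cmp_assoc[OF v(1) k u(1)] v u(2) Cmp_Zer_left[OF v(1)] Hom_Obj(2)[OF u(1)] by simp
    then show "\<exists>v \<in> Hom A (Tgt A f) W. v \<cdot> f = u" using cokernel_desc[OF cok f g u(1)] by blast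
  qed
qed

lemma mono_image:
  assumes "is_mono A f"
  shows "is_image A f f"
proof -
  obtain c where "is_cokernel A c f" using ex_cokernel assms unfolding is_mono_def by blast
  then show ?thesis unfolding is_image_def using mono_kernel_of_cokernel[OF assms] by blast
qed

lemma ex_image:
  assumes "f \<in> Arr A"
  shows "\<exists>m. is_image A m f"
proof -
  obtain c where c: "is_cokernel A c f" using ex_cokernel assms by blast
  then obtain m where "is_kernel A m c" using ex_kernel unfolding is_cokernel_def by blast
  then show ?thesis unfolding is_image_def using c by blast
qed

text \<open>\<open>e\<close> is the lift of \<open>f\<close> along the kernel \<open>m\<close> of
  its cokernel. That \<open>e\<close> is epic rests on the axiom that every monomorphism is a
  kernel.\<close>

lemma image_factor:
  assumes img: "is_image A m f" and f: "f \<in> Hom A X Y"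
  obtains e where "m \<in> Hom A (Src A m) Y" "is_mono A m" "e \<in> Hom A X (Src A m)" "m \<cdot> e = f" "is_epi A e"
proof -
  obtain c where cok: "is_cokernel A c f" and ker: "is_kernel A m c"
    using img unfolding is_image_def by blast
  note c = cokernel_Hom[OF cok f]
  note m = kernel_Hom[OF ker c] and mono = kernel_mono[OF ker]
  obtain e where e: "e \<in> Hom A X (Src A m)" "m \<cdot> e = f"
    using kernel_lift[OF ker m c f cokernel_zero[OF cok c f]] .
  have "is_epi A e"
  proof (rule epiI[OF e(1)])
    fix W u assume u: "u \<in> Hom A (Src A m) W" "u \<cdot> e = Zer A X W"
    \<comment> \<open>\<open>f\<close> factors through the subobject \<open>m \<cdot> k\<close> of its image \<open>m\<close>, where \<open>k\<close> is the kernel of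
      \<open>u\<close>; minimality of the image makes \<open>k\<close> a split epimorphism.\<close>
    obtain k where k0: "is_kernel A k u" using ex_kernel[OF Hom_Arr[OF u(1)]] by blast
    note k = kernel_Hom[OF k0 u(1)]
    obtain e' where e': "e' \<in> Hom A X (Src A k)" "k \<cdot> e' = e" using kernel_lift[OF k0 k u(1) e(1) u(2)] .
    have mk: "m \<cdot> k \<in> Hom A (Src A k) Y" using Cmp_in_Hom k m by blast
    have "is_mono A (m \<cdot> k)"
    proof (rule monoI[OF mk])
      fix V w assume w: "w \<in> Hom A V (Src A k)" "(m \<cdot> k) \<cdot> w = Zer A V Y"
      then have "k \<cdot> w = Zer A V (Src A m)"
        using mono_zero[OF mono m Cmp_in_Hom[OF w(1) k]] Cmp_assoc[OF w(1) k m] by simp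
      then show "w = Zer A V (Src A k)" using mono_zero[OF kernel_mono[OF k0] k w(1)] by simp
    qed
    \<comment> \<open>This \<open>g\<close> kills \<open>f\<close>, hence factors through the
      cokernel \<open>c\<close> and kills \<open>m\<close> as well, so \<open>m\<close> lifts along
      \<open>m \<cdot> k\<close>.\<close>
    then obtain g where g0: "is_kernel A (m \<cdot> k) g" using mono_is_kernel by blast
    have g: "g \<in> Hom A Y (Tgt A g)" using g0 Hom_Tgt[OF mk] by (simp add: is_kernel_def Hom_def)
    have "(m \<cdot> k) \<cdot> e' = f" using Cmp_assoc[OF e'(1) k m] e' e by simp
    then have "g \<cdot> f = Zer A X (Tgt A g)"
      using Cmp_assoc[OF e'(1) mk g] kernel_zero[OF g0 mk g] Cmp_Zer_left[OF e'(1)] Hom_Obj(2)[OF g]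
      by simp
    then obtain g' where g': "g' \<in> Hom A (Tgt A c) (Tgt A g)" "g' \<cdot> c = g"
      using cokernel_desc[OF cok c f g] by blast
    have "g \<cdot> m = Zer A (Src A m) (Tgt A g)"
      using Cmp_assoc[OF m c g'(1)] g' kernel_zero[OF ker m c] Cmp_Zer_right[OF g'(1)] Hom_Obj(1)[OF m]
      by simp
    then obtain t where t: "t \<in> Hom A (Src A m) (Src A k)" "(m \<cdot> k) \<cdot> t = m"
      using kernel_lift[OF g0 mk g m] by blast
    have "m \<cdot> (k \<cdot> t) = m \<cdot> Idt A (Src A m)"
      using Cmp_assoc[OF t(1) k m] t(2) Cmp_Idt_right[OF m] by simp
    then have "k \<cdot> t = Idt A (Src A m)"
      using mono_cancel[OF mono m Cmp_in_Hom[OF t(1) k] Idt_in_Hom] Hom_Obj(1)[OF m] by blast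
    then show "u = Zer A (Src A m) W"
      using Cmp_assoc[OF t(1) k u(1)] kernel_zero[OF k0 k u(1)] Cmp_Zer_left[OF t(1)]
        Hom_Obj(2)[OF u(1)] Cmp_Idt_right[OF u(1)] by simp
  qed
  then show thesis using that[OF m mono e] by simp
qed

text \<open>\<open>exact_at\<close> provides only some image \<open>n\<close>; this makes every
  image usable. Two cokernels of \<open>f\<close> factor through each other, and \<open>c'\<close>
  and \<open>g\<close> share the kernel \<open>n\<close>, so \<open>c\<close> and \<open>g\<close>
  annihilate the same arrows.\<close>

lemma exact_at_image_kernel:
  assumes ex: "exact_at A f g" and img: "is_image A m f"
  shows "is_kernel A m g"
proof -
  obtain n where n0: "is_image A n f" "is_kernel A n g" using ex unfolding exact_at_def by blast
  obtain c where c0: "is_cokernel A c f" "is_kernel A m c" using img unfolding is_image_def by blast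
  obtain c' where c'0: "is_cokernel A c' f" "is_kernel A n c'" using n0(1) unfolding is_image_def by blast
  have f: "f \<in> Hom A (Src A f) (Tgt A f)" and g: "g \<in> Hom A (Tgt A f) (Tgt A g)"
    using ex unfolding exact_at_def Hom_def by auto
  note c = cokernel_Hom[OF c0(1) f] and c' = cokernel_Hom[OF c'0(1) f]
  note n = kernel_Hom[OF n0(2) g]
  obtain v where v: "v \<in> Hom A (Tgt A c') (Tgt A c)" "v \<cdot> c' = c"
    using cokernel_desc[OF c'0(1) c' f c cokernel_zero[OF c0(1) c f]] .
  obtain v' where v': "v' \<in> Hom A (Tgt A c) (Tgt A c')" "v' \<cdot> c = c'"
    using cokernel_desc[OF c0(1) c f c' cokernel_zero[OF c'0(1) c' f]] .
  show ?thesis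
  proof (rule kernel_transfer[OF c0(2) c g])
    fix W u assume u: "u \<in> Hom A W (Tgt A f)"
    then have W: "W \<in> Obj A" using Hom_Obj by blast
    have through: "h \<cdot> u = Zer A W (Tgt A h)"
      if h0: "is_kernel A n h" and h: "h \<in> Hom A (Tgt A f) (Tgt A h)" and w: "w \<in> Hom A W (Src A n)" "n \<cdot> w = u" for h w
      using Cmp_assoc[OF w(1) n h] w(2) kernel_zero[OF h0 n h] Cmp_Zer_left[OF w(1)] Hom_Obj(2)[OF h] by simp
    show "c \<cdot> u = Zer A W (Tgt A c) \<longleftrightarrow> g \<cdot> u = Zer A W (Tgt A g)"
    proof
      assume "c \<cdot> u = Zer A W (Tgt A c)"
      then have "c' \<cdot> u = Zer A W (Tgt A c')"
        using Cmp_assoc[OF u c v'(1)] v'(2) Cmp_Zer_right[OF v'(1) W] by simp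
      then show "g \<cdot> u = Zer A W (Tgt A g)"
        using kernel_lift[OF c'0(2) n c' u] through[OF n0(2) g] by blast
    next
      assume "g \<cdot> u = Zer A W (Tgt A g)"
      then have "c' \<cdot> u = Zer A W (Tgt A c')"
        using kernel_lift[OF n0(2) n g u] through[OF c'0(2) c'] by blast
      then show "c \<cdot> u = Zer A W (Tgt A c)"
        using Cmp_assoc[OF u c' v(1)] v(2) Cmp_Zer_right[OF v(1) W] by simp
    qed
  qed
qed

section \<open>Extensions\<close>

text \<open>The working form of a short exact sequence. The zero on the left forces \<open>f\<close>
  to be monic, hence its own image and by exactness a kernel of \<open>g\<close>; the zero on the
  right forces \<open>g\<close> to be epic.\<close>

lemma extension_iff:
  "is_extension A 1 X Y es \<longleftrightarrow> (\<exists>f g E. es = [f, g] \<and> f \<in> Hom A Y E \<and> g \<in> Hom A E X \<and>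
    is_kernel A f g \<and> is_epi A g)" (is "?L \<longleftrightarrow> ?R")
proof
  assume ?L
  then obtain Z where len: "length es = 2" and ends: "Src A (hd es) = Y" "Tgt A (last es) = X"
    and Z: "is_zero_object A Z" and ex: "exact_list A (Zer A Z Y # es @ [Zer A X Z])"
    unfolding is_extension_def by auto
  obtain f g where es: "es = [f, g]" using len by (auto simp: numeral_2_eq_2 length_Suc_conv)
  have ex: "exact_at A (Zer A Z Y) f" "exact_at A f g" "exact_at A g (Zer A X Z)"
    using ex[unfolded exact_list_def es, rule_format, of 0] ex[unfolded exact_list_def es, rule_format, of 1]
      ex[unfolded exact_list_def es, rule_format, of 2] by (simp_all add: numeral_2_eq_2)
  define E where "E = Tgt A f"
  have f: "f \<in> Hom A Y E" and g: "g \<in> Hom A E X"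
    using ends ex es unfolding exact_at_def E_def Hom_def by auto
  have O: "X \<in> Obj A" "Y \<in> Obj A" "Z \<in> Obj A" using f g Z Hom_Obj zero_object_Obj by blast+
  have i: "Idt A Y \<in> Hom A Y Y" "is_mono A (Idt A Y)"
    using O Idt_in_Hom kernel_mono kernel_Zer by blast+
  have "is_image A (Zer A Z Y) (Zer A Z Y)"
    unfolding is_image_def using cokernel_Zer O mono_kernel_zero_object[OF Z i] by blast
  then have k: "is_kernel A (Zer A Z Y) f" using exact_at_image_kernel ex(1) by blast
  have "is_mono A f"
  proof (rule monoI[OF f])
    fix W u assume u: "u \<in> Hom A W Y" "f \<cdot> u = Zer A W E"
    obtain v where v: "v \<in> Hom A W Z" "Zer A Z Y \<cdot> v = u"
      using kernel_lift[OF k Zer_in_Hom[OF O(3,2)] f u] .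
    then show "u = Zer A W Y" using Cmp_Zer_left O by metis
  qed
  then have ker: "is_kernel A f g" using mono_image exact_at_image_kernel ex(2) by blast
  obtain m where m: "is_image A m g" using ex_image[OF Hom_Arr[OF g]] by blast
  then have m0: "is_kernel A m (Zer A X Z)" using exact_at_image_kernel ex(3) by blast
  obtain e where e: "m \<in> Hom A (Src A m) X" "is_mono A m" "e \<in> Hom A E (Src A m)" "m \<cdot> e = g" "is_epi A e"
    using image_factor[OF m g] .
  \<comment> \<open>The image \<open>m\<close> of \<open>g\<close> is a kernel of the zero arrow out
    of \<open>X\<close>, which kills the identity. So \<open>m\<close> has a section, and
    \<open>g = m \<cdot> e\<close> is a composite of epimorphisms.\<close>
  have iX: "Idt A X \<in> Hom A X X" using O Idt_in_Hom by blast
  obtain s where s: "s \<in> Hom A X (Src A m)" "m \<cdot> s = Idt A X"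
    using kernel_lift[OF m0 e(1) Zer_in_Hom[OF O(1,3)] iX Cmp_Zer_left[OF iX O(3)]] .
  have "is_epi A g"
  proof (rule epiI[OF g])
    fix W u assume u: "u \<in> Hom A X W" "u \<cdot> g = Zer A E W"
    then have "u \<cdot> m = Zer A (Src A m) W"
      using epi_zero[OF e(5,3) Cmp_in_Hom[OF e(1) u(1)]] Cmp_assoc[OF e(3,1) u(1)] e(4) by simp
    then show "u = Zer A X W"
      using epi_zero[OF split_epi[OF e(1) s] e(1) u(1)] by blast
  qed
  then show ?R using es f g ker by blast
next
  assume ?R
  then obtain f g E where es: "es = [f, g]" and f: "f \<in> Hom A Y E" and g: "g \<in> Hom A E X"
    and ker: "is_kernel A f g" and epi: "is_epi A g" by blast
  obtain Z where Z: "is_zero_object A Z" using ex_zero_object by blast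
  have "exact_at A (Zer A Z Y) f" using exact_at_zero_mono[OF Z f kernel_mono[OF ker]] .
  moreover have "exact_at A f g"
    unfolding exact_at_def using mono_image[OF kernel_mono[OF ker]] ker f g by (auto simp: Hom_def)
  moreover have "exact_at A g (Zer A X Z)" using exact_at_epi_zero[OF Z g epi] by blast
  ultimately have "exact_list A (Zer A Z Y # es @ [Zer A X Z])"
    unfolding exact_list_def es by (auto simp: nth_Cons split: nat.splits)
  then show ?L unfolding is_extension_def using es Z f g by (auto simp: Hom_def)
qed

text \<open>The complement \<open>h\<close> of the idempotent \<open>s \<cdot> g\<close> is killed
  by \<open>g\<close>, so it lifts along \<open>f\<close>; the lift is the retraction.\<close>

lemma section_retraction:
  assumes f: "f \<in> Hom A Y E" and g: "g \<in> Hom A E X" and ker: "is_kernel A f g"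
    and s: "s \<in> Hom A X E" "g \<cdot> s = Idt A X"
  obtains r where "r \<in> Hom A E Y" "r \<cdot> f = Idt A Y" "Add A (f \<cdot> r) (s \<cdot> g) = Idt A E" "r \<cdot> s = Zer A X Y"
proof -
  have O: "X \<in> Obj A" "Y \<in> Obj A" "E \<in> Obj A" using f g Hom_Obj by blast+
  have sg: "s \<cdot> g \<in> Hom A E E" and i: "Idt A E \<in> Hom A E E" using Cmp_in_Hom g s Idt_in_Hom O by blast+
  obtain h where h: "h \<in> Hom A E E" "Add A h (s \<cdot> g) = Idt A E" using difference_exists[OF i sg] .
  have "g \<cdot> (s \<cdot> g) = g" using Cmp_assoc[OF g s(1) g] s(2) Cmp_Idt_left[OF g] by simp
  then have "Add A (g \<cdot> h) g = g" using Cmp_Add_right[OF h(1) sg g] h(2) Cmp_Idt_right[OF g] by simp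
  then have "g \<cdot> h = Zer A E X" using Add_eq_right[OF Cmp_in_Hom[OF h(1) g] g] by simp
  then obtain r where r: "r \<in> Hom A E Y" "f \<cdot> r = h" using kernel_lift[OF ker f g h(1)] by blast
  \<comment> \<open>Since \<open>f\<close> is monic, equations about \<open>r\<close> can be tested
    after composing with \<open>f\<close>, that is, on \<open>h\<close>.\<close>
  have cancel: "r \<cdot> u = v"
    if u: "u \<in> Hom A W E" and v: "v \<in> Hom A W Y" and eq: "h \<cdot> u = f \<cdot> v" for W u v
    using mono_cancel[OF kernel_mono[OF ker] f Cmp_in_Hom[OF u r(1)] v] Cmp_assoc[OF u r(1) f] r(2) eq
    by simp
  have expand: "Add A (h \<cdot> u) (s \<cdot> (g \<cdot> u)) = u" if u: "u \<in> Hom A W E" for W u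
    using Cmp_Add_left[OF u h(1) sg] h(2) Cmp_Idt_left[OF u] Cmp_assoc[OF u g s(1)] by simp
  have "Add A (h \<cdot> s) s = s" using expand[OF s(1)] s(2) Cmp_Idt_right[OF s(1)] by simp
  then have "h \<cdot> s = f \<cdot> Zer A X Y"
    using Add_eq_right[OF Cmp_in_Hom[OF s(1) h(1)] s(1)] Cmp_Zer_right[OF f O(1)] by simp
  then have rs: "r \<cdot> s = Zer A X Y" using cancel[OF s(1) Zer_in_Hom] O by blast
  have "Add A (h \<cdot> f) (Zer A Y E) = f"
    using expand[OF f] kernel_zero[OF ker f g] Cmp_Zer_right[OF s(1) O(2)] by simp
  moreover have "Add A f (Zer A Y E) = f"
    using Add_Zer_right[OF f] .
  ultimately have "h \<cdot> f = f \<cdot> Idt A Y"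
    using Add_right_cancel[OF Cmp_in_Hom[OF f h(1)] f Zer_in_Hom] O Cmp_Idt_right[OF f] by simp
  then have "r \<cdot> f = Idt A Y" using cancel[OF f Idt_in_Hom] O by blast
  then show thesis using that r h rs by blast
qed

text \<open>Dually, the complement \<open>h\<close> of \<open>f \<cdot> r\<close> kills
  \<open>f\<close> and descends along the cokernel \<open>g\<close> to \<open>s\<close>; the section
  equation is tested after precomposing with the epimorphism \<open>g\<close>.\<close>

lemma retraction_section:
  assumes f: "f \<in> Hom A Y E" and g: "g \<in> Hom A E X" and cok: "is_cokernel A g f"
    and r: "r \<in> Hom A E Y" "r \<cdot> f = Idt A Y"
  obtains s where "s \<in> Hom A X E" "g \<cdot> s = Idt A X"
proof -
  have O: "X \<in> Obj A" "Y \<in> Obj A" "E \<in> Obj A" using f g Hom_Obj by blast+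
  have fr: "f \<cdot> r \<in> Hom A E E" and i: "Idt A E \<in> Hom A E E" using Cmp_in_Hom f r Idt_in_Hom O by blast+
  obtain h where h: "h \<in> Hom A E E" "Add A h (f \<cdot> r) = Idt A E" using difference_exists[OF i fr] .
  have "(f \<cdot> r) \<cdot> f = f" using Cmp_assoc[OF f r(1) f] r(2) Cmp_Idt_right[OF f] by simp
  then have "Add A (h \<cdot> f) f = f" using Cmp_Add_left[OF f h(1) fr] h(2) Cmp_Idt_left[OF f] by simp
  then have "h \<cdot> f = Zer A Y E" using Add_eq_right[OF Cmp_in_Hom[OF f h(1)] f] by simp
  then obtain s where s: "s \<in> Hom A X E" "s \<cdot> g = h" using cokernel_desc[OF cok g f h(1)] by blast
  have "g \<cdot> (f \<cdot> r) = Zer A E X"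
    using Cmp_assoc[OF r(1) f g] cokernel_zero[OF cok g f] Cmp_Zer_left[OF r(1) O(1)] by simp
  then have "Add A (g \<cdot> h) (Zer A E X) = g"
    using Cmp_Add_right[OF h(1) fr g] h(2) Cmp_Idt_right[OF g] by simp
  moreover have "Add A g (Zer A E X) = g"
    using Add_Zer_right[OF g] .
  ultimately have "g \<cdot> h = g"
    using Add_right_cancel[OF Cmp_in_Hom[OF h(1) g] g Zer_in_Hom] O by simp
  then have "(g \<cdot> s) \<cdot> g = Idt A X \<cdot> g" using Cmp_assoc[OF g s(1) g] s(2) Cmp_Idt_left[OF g] by simp
  then have "g \<cdot> s = Idt A X"
    using epi_cancel[OF cokernel_epi[OF cok] g Cmp_in_Hom[OF s(1) g] Idt_in_Hom] O by blast
  then show thesis using that s by blast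
qed

section \<open>Split extensions and the vanishing of the first Yoneda Ext\<close>

definition split_extension :: "'a \<Rightarrow> 'a \<Rightarrow> 'b list \<Rightarrow> bool" where
  "split_extension X Y es \<longleftrightarrow> is_extension A 1 X Y es \<and>
    (\<exists>s \<in> Hom A X (Src A (es ! 1)). (es ! 1) \<cdot> s = Idt A X)"

text \<open>An epimorphism is a cokernel of its kernel, so sections and retractions yield each
  other. The retraction form is the one that transports backwards along a morphism of
  extensions.\<close>

lemma split_extension_iff_retraction:
  assumes "is_extension A 1 X Y es"
  shows "split_extension X Y es \<longleftrightarrow> (\<exists>r \<in> Hom A (Src A (es ! 1)) Y. r \<cdot> (es ! 0) = Idt A Y)"
proof -
  obtain f g E where es: "es = [f, g]" and f: "f \<in> Hom A Y E" and g: "g \<in> Hom A E X"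
    and ker: "is_kernel A f g" and epi: "is_epi A g" using assms extension_iff by blast
  show ?thesis
    unfolding split_extension_def
    using assms section_retraction[OF f g ker] retraction_section[OF f g epi_cokernel_of_kernel[OF epi ker]]
      Hom_Src[OF g] by (auto simp: es) blast+
qed

lemma ext_morphism_split_iff:
  assumes "ext_morphism A 1 X Y es es'"
  shows "split_extension X Y es \<longleftrightarrow> split_extension X Y es'"
proof -
  have ext: "is_extension A 1 X Y es" "is_extension A 1 X Y es'"
    using assms unfolding ext_morphism_def by auto
  obtain f g E where es: "es = [f, g]" and f: "f \<in> Hom A Y E" and g: "g \<in> Hom A E X"
    using ext(1) extension_iff by blast
  obtain f' g' E' where es': "es' = [f', g']" and f': "f' \<in> Hom A Y E'" and g': "g' \<in> Hom A E' X"
    using ext(2) extension_iff by blast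
  obtain \<phi> where \<phi>: "\<phi> 0 = Idt A Y" "\<phi> (Suc 1) = Idt A X"
    and i: "\<forall>i \<le> 1. \<phi> i \<in> Hom A (Src A (es ! i)) (Src A (es' ! i)) \<and>
        \<phi> (Suc i) \<in> Hom A (Tgt A (es ! i)) (Tgt A (es' ! i)) \<and>
        \<phi> (Suc i) \<cdot> (es ! i) = (es' ! i) \<cdot> \<phi> i"
    using assms unfolding ext_morphism_def by blast
  \<comment> \<open>The middle component. The squares at indices 0 and 1, with identities at the
    outer ends, become the two triangles for \<open>p\<close>.\<close>
  define p where "p = \<phi> 1"
  have p: "p \<in> Hom A E E'" "p \<cdot> f = f'" "g' \<cdot> p = g"
    using i[rule_format, of 0] i[rule_format, of 1] \<phi> Hom_Src[OF g] Hom_Src[OF g']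
      Cmp_Idt_right[OF f'] Cmp_Idt_left[OF g]
    by (auto simp: es es' p_def)
  show ?thesis
  proof
    assume "split_extension X Y es"
    then obtain s where s: "s \<in> Hom A X E" "g \<cdot> s = Idt A X"
      using Hom_Src[OF g] by (auto simp: split_extension_def es)
    then have "g' \<cdot> (p \<cdot> s) = Idt A X" using Cmp_assoc[OF s(1) p(1) g'] p by simp
    then show "split_extension X Y es'"
      using ext Cmp_in_Hom[OF s(1) p(1)] Hom_Src[OF g'] by (auto simp: split_extension_def es')
  next
    assume "split_extension X Y es'"
    then obtain r where r: "r \<in> Hom A E' Y" "r \<cdot> f' = Idt A Y"
      using split_extension_iff_retraction[OF ext(2)] Hom_Src[OF g'] by (auto simp: es')
    then have "(r \<cdot> p) \<cdot> f = Idt A Y" using Cmp_assoc[OF f p(1) r(1)] p by simp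
    then show "split_extension X Y es"
      using split_extension_iff_retraction[OF ext(1)] Cmp_in_Hom[OF p(1) r(1)] Hom_Src[OF g]
      by (auto simp: es)
  qed
qed

text \<open>The biproduct sequence. It is the base point with which a given extension is compared
  when Ext is a singleton.\<close>

lemma ex_split_extension:
  assumes "X \<in> Obj A" "Y \<in> Obj A"
  shows "\<exists>es. split_extension X Y es"
proof -
  obtain S where "is_biproduct A Y X S" using ex_biproduct assms by blast
  then obtain i j p q where i: "i \<in> Hom A Y S" and j: "j \<in> Hom A X S" and p: "p \<in> Hom A S Y"
    and q: "q \<in> Hom A S X" and eqs: "p \<cdot> i = Idt A Y" "q \<cdot> j = Idt A X" "q \<cdot> i = Zer A Y X"
      "Add A (i \<cdot> p) (j \<cdot> q) = Idt A S"
    unfolding is_biproduct_def by blast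
  have "is_kernel A i q"
  proof (rule kernelI[OF i q split_mono[OF i p eqs(1)] eqs(3)])
    fix W u assume u: "u \<in> Hom A W S" "q \<cdot> u = Zer A W X"
    then have W: "W \<in> Obj A" using Hom_Obj by blast
    have "Add A (i \<cdot> (p \<cdot> u)) (Zer A W S) = u"
      using Cmp_Add_left[OF u(1) Cmp_in_Hom[OF p i] Cmp_in_Hom[OF q j]] eqs(4) Cmp_Idt_left[OF u(1)]
        Cmp_assoc[OF u(1) p i] Cmp_assoc[OF u(1) q j] u(2) Cmp_Zer_right[OF j W] by simp
    moreover have "Add A (i \<cdot> (p \<cdot> u)) (Zer A W S) = i \<cdot> (p \<cdot> u)"
      using Add_Zer_right[OF Cmp_in_Hom[OF Cmp_in_Hom[OF u(1) p] i]] .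
    ultimately show "\<exists>v \<in> Hom A W Y. i \<cdot> v = u" using Cmp_in_Hom[OF u(1) p] by auto
  qed
  then have "is_extension A 1 X Y [i, q]"
    unfolding extension_iff using i q split_epi[OF q j eqs(2)] by auto
  then have "split_extension X Y [i, q]"
    unfolding split_extension_def using j eqs(2) Hom_Src[OF q] by auto
  then show ?thesis by blast
qed

text \<open>A singleton quotient puts \<open>es\<close> into the class of a split extension, and
  splitting is carried along the zigzag of morphisms joining the two.\<close>

lemma Ext_vanishes_split:
  assumes van: "Ext_vanishes A 1 X Y" and es: "is_extension A 1 X Y es"
  shows "split_extension X Y es"
proof -
  let ?r = "{(es, es'). ext_morphism A 1 X Y es es' \<or> ext_morphism A 1 X Y es' es}"
  obtain f g E where "f \<in> Hom A Y E" "g \<in> Hom A E X" using es unfolding extension_iff by blast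
  then obtain es0 where es0: "split_extension X Y es0" using ex_split_extension Hom_Obj by blast
  obtain c where "Ext A 1 X Y = {c}" using van unfolding Ext_vanishes_def is_singleton_def by blast
  moreover have "?r\<^sup>* `` {es'} \<in> Ext A 1 X Y" if "is_extension A 1 X Y es'" for es'
    unfolding Ext_def by (rule quotientI) (use that in simp)
  moreover have "is_extension A 1 X Y es0" using es0 unfolding split_extension_def by blast
  ultimately have "?r\<^sup>* `` {es0} = c" "?r\<^sup>* `` {es} = c" using es by (simp_all only: singleton_iff)
  then have "?r\<^sup>* `` {es0} = ?r\<^sup>* `` {es}" by (simp only:)
  \<comment> \<open>By reflexivity \<open>es\<close> lies in its own class, which is also the class
    of \<open>es0\<close>.\<close>
  then have "(es0, es) \<in> ?r\<^sup>*" by auto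
  then show ?thesis
  proof (induction rule: rtrancl_induct)
    case base
    show ?case by (rule es0)
  next
    case (step es es')
    then show ?case using ext_morphism_split_iff[of X Y es es'] ext_morphism_split_iff[of X Y es' es] by auto
  qed
qed

text \<open>The kernel object \<open>Y\<close> comes first because
  \<open>closed_under_summands\<close> extracts the first summand.\<close>

lemma Ext_vanishes_biproduct:
  assumes van: "Ext_vanishes A 1 X Y" and f: "f \<in> Hom A Y E" and g: "g \<in> Hom A E X"
    and ker: "is_kernel A f g" and epi: "is_epi A g"
  shows "is_biproduct A Y X E"
proof -
  have "is_extension A 1 X Y [f, g]" unfolding extension_iff using f g ker epi by blast
  from Ext_vanishes_split[OF van this]
  obtain s where s: "s \<in> Hom A X E" "g \<cdot> s = Idt A X"
    unfolding split_extension_def using Hom_Src[OF g] by auto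
  obtain r where "r \<in> Hom A E Y" "r \<cdot> f = Idt A Y" "Add A (f \<cdot> r) (s \<cdot> g) = Idt A E" "r \<cdot> s = Zer A X Y"
    using section_retraction[OF f g ker s] .
  then show ?thesis
    unfolding is_biproduct_def using Hom_Obj f g s kernel_zero[OF ker f g] by blast
qed

section \<open>The Gorenstein subcategory\<close>

text \<open>All conditions on \<open>d\<close> range over every integer, so they survive the
  translation that moves \<open>d k\<close> to index 0.\<close>

lemma image_in_Gorenstein:
  assumes ex: "is_exact_sequence A d" and C: "\<And>n. Src A (d n) \<in> C"
    and hom: "Hom_from_exact A C d" "Hom_to_exact A C d" and m: "is_image A m (d k)"
  shows "Src A m \<in> Gorenstein A C"
proof -
  let ?d = "\<lambda>n. d (k + n)"
  have "d k \<in> Arr A" using ex unfolding is_exact_sequence_def exact_at_def by blast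
  from Arr_Hom[OF this] have "Src A m \<in> Obj A" using image_factor[OF m] Hom_Obj by metis
  moreover have "is_exact_sequence A ?d"
    using ex unfolding is_exact_sequence_def by (simp add: add.assoc[symmetric])
  moreover have "Hom_from_exact A C ?d"
    using hom(1) unfolding Hom_from_exact_def by (simp add: add.assoc[symmetric])
  moreover have "Hom_to_exact A C ?d"
    using hom(2) unfolding Hom_to_exact_def by (simp add: add.assoc[symmetric])
  ultimately show ?thesis
    unfolding Gorenstein_def using C m isomorphic_refl by (auto intro!: exI[of _ ?d])
qed

lemma Gorenstein_subset:
  assumes sub: "is_subcategory A C" and summands: "closed_under_summands A C"
    and perp: "Gorenstein A C \<subseteq> right_perp1 A (Gorenstein A C)"
  shows "Gorenstein A C \<subseteq> C"
proof
  fix M assume M: "M \<in> Gorenstein A C"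
  then obtain d m where ex: "is_exact_sequence A d" and C: "\<forall>n. Src A (d n) \<in> C"
    and hom: "Hom_from_exact A C d" "Hom_to_exact A C d" and m: "is_image A m (d 0)"
    and iso: "isomorphic A M (Src A m)"
    unfolding Gorenstein_def by blast
  have exn: "exact_at A (d n) (d (n + 1))" for n using ex unfolding is_exact_sequence_def by blast
  have d0: "d 0 \<in> Hom A (Src A (d 0)) (Src A (d 1))" and d1: "d 1 \<in> Hom A (Src A (d 1)) (Tgt A (d 1))"
    using exn[of 0] by (simp_all add: exact_at_def Hom_def)
  have ker: "is_kernel A m (d 1)" using exact_at_image_kernel[OF _ m] exn[of 0] by simp
  note mh = kernel_Hom[OF ker d1]
  obtain n where n: "is_image A n (d 1)" using ex_image[OF Hom_Arr[OF d1]] by blast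
  obtain e where e: "n \<in> Hom A (Src A n) (Tgt A (d 1))" "is_mono A n"
      "e \<in> Hom A (Src A (d 1)) (Src A n)" "n \<cdot> e = d 1" "is_epi A e"
    using image_factor[OF n d1] .
  \<comment> \<open>As \<open>n\<close> is monic, \<open>d 1 = n \<cdot> e\<close> and
    \<open>e\<close> kill the same arrows. With \<open>e\<close> epic, \<open>m\<close> and
    \<open>e\<close> form a short exact sequence whose middle term is in \<open>C\<close>.\<close>
  have "is_kernel A m e"
  proof (rule kernel_transfer[OF ker d1 e(3)])
    fix W u assume u: "u \<in> Hom A W (Src A (d 1))"
    note eu = Cmp_in_Hom[OF u e(3)] and assoc = Cmp_assoc[OF u e(3,1), unfolded e(4)]
    show "d 1 \<cdot> u = Zer A W (Tgt A (d 1)) \<longleftrightarrow> e \<cdot> u = Zer A W (Src A n)"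
      unfolding assoc using mono_zero[OF e(2,1) eu] Cmp_Zer_right[OF e(1) Hom_Obj(1)[OF u]] by auto
  qed
  moreover have "Ext_vanishes A 1 (Src A n) (Src A m)"
  proof -
    have "Src A m \<in> Gorenstein A C" "Src A n \<in> Gorenstein A C"
      using image_in_Gorenstein[OF ex _ hom] C m n by blast+
    then show ?thesis using perp unfolding right_perp1_def by blast
  qed
  ultimately have "is_biproduct A (Src A m) (Src A n) (Src A (d 1))"
    using Ext_vanishes_biproduct[OF _ mh e(3) _ e(5)] by simp
  \<comment> \<open>\<open>M\<close> is only isomorphic to the image \<open>Src A m\<close>, so
    closure under isomorphisms finishes the argument.\<close>
  then have "Src A m \<in> C" using summands C unfolding closed_under_summands_def by blast
  then show "M \<in> C" using sub isomorphic_sym[OF iso] unfolding is_subcategory_def by blast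
qed

lemma Gorenstein_superset:
  assumes sub: "is_subcategory A C"
  shows "C \<subseteq> Gorenstein A C"
proof
  fix X assume X: "X \<in> C"
  obtain Z where ZC: "Z \<in> C" and Z: "is_zero_object A Z" using sub unfolding is_subcategory_def by blast
  have CO: "C \<subseteq> Obj A" using sub unfolding is_subcategory_def by blast
  then have O: "X \<in> Obj A" "Z \<in> Obj A" using X ZC by blast+
  \<comment> \<open>The zero object comes from \<open>C\<close>, which keeps all terms in
    \<open>C\<close>; the identity sits at index 0, so that \<open>X\<close> is the image of
    \<open>d 0\<close>.\<close>
  define d :: "int \<Rightarrow> 'b" where
    "d n = (if n = -1 then Zer A Z X else if n = 0 then Idt A X else if n = 1 then Zer A X Z else Zer A Z Z)" for n
  have zX: "Zer A Z X \<in> Hom A Z X" and Xz: "Zer A X Z \<in> Hom A X Z" and zz: "Zer A Z Z \<in> Hom A Z Z"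
    and i: "Idt A X \<in> Hom A X X" using O Zer_in_Hom Idt_in_Hom by blast+
  have idz: "Idt A Z = Zer A Z Z" using Hom_to_zero_object[OF Z] Idt_in_Hom O by blast
  \<comment> \<open>Pairs of arrows of these two shapes are exact and stay exact under every additive functor.\<close>
  have cases: "(\<exists>Y W. d n = Zer A Z Y \<and> d (n + 1) \<in> Hom A Y W \<and> (\<exists>r \<in> Hom A W Y. r \<cdot> d (n + 1) = Idt A Y)) \<or>
      (\<exists>Y W. d (n + 1) = Zer A W Z \<and> d n \<in> Hom A Y W \<and> (\<exists>s \<in> Hom A W Y. d n \<cdot> s = Idt A W))" for n
  proof -
    \<comment> \<open>At 1 and -2 the arrows between \<open>X\<close> and \<open>Z\<close> split as
      an epimorphism and as a monomorphism, because the identity of \<open>Z\<close> is zero. Away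
      from -2, -1, 0 and 1 both arrows are \<open>Zer A Z Z\<close>.\<close>
    consider "n = -1" | "n = 0" | "n = 1" | "n = -2" | "d n = Zer A Z Z" "d (n + 1) = Zer A Z Z"
      unfolding d_def by fastforce
    then show ?thesis
    proof cases
      case 1
      then have "d n = Zer A Z X" "d (n + 1) = Idt A X" by (simp_all add: d_def)
      then show ?thesis using i Cmp_Idt_left by metis
    next
      case 2
      then have "d n = Idt A X" "d (n + 1) = Zer A X Z" by (simp_all add: d_def)
      then show ?thesis using i Cmp_Idt_left by metis
    next
      case 3
      then have "d n = Zer A X Z" "d (n + 1) = Zer A Z Z" by (simp_all add: d_def)
      then show ?thesis using Xz zX idz Cmp_Zer_right O by metis
    next
      case 4
      then have "d n = Zer A Z Z" "d (n + 1) = Zer A Z X" by (simp_all add: d_def)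
      then show ?thesis using Xz zX idz Cmp_Zer_right O by metis
    next
      case 5
      then show ?thesis using zz idz Cmp_Zer_right O by metis
    qed
  qed
  have "is_exact_sequence A d"
    unfolding is_exact_sequence_def
    using cases exact_at_zero_mono[OF Z] exact_at_epi_zero(1)[OF Z] split_mono split_epi by metis
  moreover have "Hom_from_exact A C d"
    unfolding Hom_from_exact_def
  proof (intro ballI allI)
    fix V n assume "V \<in> C"
    then have V: "V \<in> Obj A" using CO by blast
    show "(\<lambda>h. d n \<cdot> h) ` carrier (Hom_group A V (Src A (d n))) =
      kernel (Hom_group A V (Src A (d (n + 1)))) (Hom_group A V (Tgt A (d (n + 1)))) (\<lambda>h. d (n + 1) \<cdot> h)"
      using cases[of n]
    proof (elim disjE exE conjE bexE)
      \<comment> \<open>Both sides are zero: \<open>d n\<close> starts at \<open>Z\<close>, and the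
        split monomorphism \<open>d (n + 1)\<close> kills nothing else.\<close>
      fix Y W r assume dn: "d n = Zer A Z Y" and f: "d (n + 1) \<in> Hom A Y W"
        and r: "r \<in> Hom A W Y" "r \<cdot> d (n + 1) = Idt A Y"
      have z: "Zer A Z Y \<in> Hom A Z Y" "Y \<in> Obj A" using Zer_in_Hom O f Hom_Obj by blast+
      have "(\<lambda>h. d n \<cdot> h) ` Hom A V Z = {Zer A V Y}"
        unfolding dn using Zer_in_Hom[OF V O(2)] Cmp_Zer_left[of _ V Z, OF _ z(2)]
        by (auto simp: image_iff intro!: bexI)
      moreover have "{h \<in> Hom A V Y. d (n + 1) \<cdot> h = Zer A V W} = {Zer A V Y}"
        using mono_zero[OF split_mono[OF f r] f] Zer_in_Hom[OF V z(2)] Cmp_Zer_right[OF f V] by blast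
      ultimately show ?thesis
        using Hom_Src[OF z(1)] Hom_Src[OF f] Hom_Tgt[OF f] dn by (simp add: kernel_def Hom_group_def)
    next
      \<comment> \<open>Both sides are all of \<open>Hom A V W\<close>: the section lifts every
        arrow, and the next map is zero.\<close>
      fix Y W s assume dn: "d (n + 1) = Zer A W Z" and f: "d n \<in> Hom A Y W"
        and s: "s \<in> Hom A W Y" "d n \<cdot> s = Idt A W"
      have z: "Zer A W Z \<in> Hom A W Z" using Zer_in_Hom O f Hom_Obj by blast
      have "u \<in> (\<lambda>h. d n \<cdot> h) ` Hom A V Y" if u: "u \<in> Hom A V W" for u
      proof (rule image_eqI)
        show "u = d n \<cdot> (s \<cdot> u)" using Cmp_assoc[OF u s(1) f] s(2) Cmp_Idt_left[OF u] by simp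
      qed (rule Cmp_in_Hom[OF u s(1)])
      then have "(\<lambda>h. d n \<cdot> h) ` Hom A V Y = Hom A V W" using Cmp_in_Hom f by blast
      moreover have "{h \<in> Hom A V W. d (n + 1) \<cdot> h = Zer A V Z} = Hom A V W"
        unfolding dn using Cmp_Zer_left[OF _ O(2)] by blast
      ultimately show ?thesis
        using Hom_Src[OF z] Hom_Tgt[OF z] Hom_Src[OF f] dn by (simp add: kernel_def Hom_group_def)
    qed
  qed
  moreover have "Hom_to_exact A C d"
    unfolding Hom_to_exact_def
  proof (intro ballI allI)
    fix V n assume "V \<in> C"
    then have V: "V \<in> Obj A" using CO by blast
    show "(\<lambda>h. h \<cdot> d (n + 1)) ` carrier (Hom_group A (Tgt A (d (n + 1))) V) =
      kernel (Hom_group A (Tgt A (d n)) V) (Hom_group A (Src A (d n)) V) (\<lambda>h. h \<cdot> d n)"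
      using cases[of n]
    proof (elim disjE exE conjE bexE)
      \<comment> \<open>Contravariance swaps the roles: the retraction extends every arrow out of
        \<open>Y\<close> to \<open>W\<close>, so here both sides are the full Hom set, and in the
        second shape both are zero.\<close>
      fix Y W r assume dn: "d n = Zer A Z Y" and f: "d (n + 1) \<in> Hom A Y W"
        and r: "r \<in> Hom A W Y" "r \<cdot> d (n + 1) = Idt A Y"
      have z: "Zer A Z Y \<in> Hom A Z Y" using Zer_in_Hom O f Hom_Obj by blast
      have "u \<in> (\<lambda>h. h \<cdot> d (n + 1)) ` Hom A W V" if u: "u \<in> Hom A Y V" for u
      proof (rule image_eqI)
        show "u = (u \<cdot> r) \<cdot> d (n + 1)" using Cmp_assoc[OF f r(1) u] r(2) Cmp_Idt_right[OF u] by simp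
      qed (rule Cmp_in_Hom[OF r(1) u])
      then have "(\<lambda>h. h \<cdot> d (n + 1)) ` Hom A W V = Hom A Y V" using Cmp_in_Hom f by blast
      moreover have "{h \<in> Hom A Y V. h \<cdot> d n = Zer A Z V} = Hom A Y V"
        unfolding dn using Cmp_Zer_right[OF _ O(2)] by blast
      ultimately show ?thesis
        using Hom_Src[OF z] Hom_Tgt[OF z] Hom_Tgt[OF f] dn by (simp add: kernel_def Hom_group_def)
    next
      fix Y W s assume dn: "d (n + 1) = Zer A W Z" and f: "d n \<in> Hom A Y W"
        and s: "s \<in> Hom A W Y" "d n \<cdot> s = Idt A W"
      have z: "Zer A W Z \<in> Hom A W Z" "W \<in> Obj A" using Zer_in_Hom O f Hom_Obj by blast+
      have "(\<lambda>h. h \<cdot> d (n + 1)) ` Hom A Z V = {Zer A W V}"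
        unfolding dn using Zer_in_Hom[OF O(2) V] Cmp_Zer_right[of _ Z V, OF _ z(2)]
        by (auto simp: image_iff intro!: bexI)
      moreover have "{h \<in> Hom A W V. h \<cdot> d n = Zer A Y V} = {Zer A W V}"
        using epi_zero[OF split_epi[OF f s] f] Zer_in_Hom[OF z(2) V] Cmp_Zer_left[OF f V] by blast
      ultimately show ?thesis
        using Hom_Tgt[OF z(1)] Hom_Src[OF f] Hom_Tgt[OF f] dn by (simp add: kernel_def Hom_group_def)
    qed
  qed
  moreover have "\<forall>n. Src A (d n) \<in> C"
    using X ZC Hom_Src[OF zX] Hom_Src[OF Xz] Hom_Src[OF zz] Hom_Src[OF i] by (simp add: d_def)
  moreover have "is_image A (Idt A X) (d 0)"
    using exact_at_epi_zero(2)[OF Z i] split_epi[OF i i] Cmp_Idt_left[OF i] by (simp add: d_def)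
  moreover have "isomorphic A X (Src A (Idt A X))" using isomorphic_refl O Hom_Src[OF i] by simp
  ultimately show "X \<in> Gorenstein A C" unfolding Gorenstein_def using O by blast
qed

end

theorem proposition3p7:
  fixes A :: "('o, 'm) preadditive_data" and C :: "'o set"
  assumes "abelian_category A"
    and "is_subcategory A C"
    and "Ext_orthogonal A C C"
    and "is_generator A (projectives A) C"
    and "closed_under_summands A C"
  shows "(right_perp1 A (Gorenstein A C) = Obj A \<longrightarrow>
            Gorenstein A C \<subseteq> right_perp1 A (Gorenstein A C))
       \<and> (Gorenstein A C \<subseteq> right_perp1 A (Gorenstein A C) \<longrightarrow> Gorenstein A C = C)
       \<and> (is_projective_generator A C (Obj A) \<longrightarrow>
            (right_perp1 A (Gorenstein A C) = Obj A \<longleftrightarrow>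
               Gorenstein A C \<subseteq> right_perp1 A (Gorenstein A C))
          \<and> (Gorenstein A C \<subseteq> right_perp1 A (Gorenstein A C) \<longleftrightarrow> Gorenstein A C = C))"
proof -
  interpret abelian_category A by fact
  have 12: "Gorenstein A C \<subseteq> right_perp1 A (Gorenstein A C)"
    if "right_perp1 A (Gorenstein A C) = Obj A"
    using that by (auto simp: Gorenstein_def)
  have 23: "Gorenstein A C = C" if "Gorenstein A C \<subseteq> right_perp1 A (Gorenstein A C)"
    using Gorenstein_subset[OF assms(2,5) that] Gorenstein_superset[OF assms(2)] by blast
  \<comment> \<open>Orthogonality of \<open>C\<close> to all objects in degree 1 becomes the first
    condition once \<open>Gorenstein A C\<close> is replaced by \<open>C\<close>; this closes the
    cycle of implications.\<close>
  have 31: "right_perp1 A (Gorenstein A C) = Obj A"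
    if "is_projective_generator A C (Obj A)" "Gorenstein A C = C"
    using that by (auto simp: is_projective_generator_def Ext_orthogonal_def right_perp1_def)
  show ?thesis using 12 23 31 by blast
qed

end
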